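(* Let $B$ be the sought causal graph, a directed acyclic graph on the variables $\mathbf{X}=(X_1,\dots,X_d)$, with binary adjacency matrix also denoted $B$. Let $B_{ij}$, $V_{ijk}$, $S_{ij}$ be the associated binary variables (ILP variables), defined in the context. Under the assumption that the Markov blanket $\mathbf{MB}(X_i)$ is true (i.e. it is the actual Markov blanket of $X_i$) for all $i\in\{1,\dots,d\}$, the ILP variables associated with $B$ satisfy all of the following linear constraints, for all $i,j,k$ with $i\neq j$, $j\neq k$, $k\neq i$, where $\mathbf{S}_i=\{X_i\}\cup\mathbf{MB}(X_i)$ and membership of indices in $\mathbf{S}_i$ means membership of the corresponding variables: (1) $B_{ij}+B_{ji}+S_{ij}\ge 1$ if $\{i,j\}\subset \mathbf{S}_i\cap\mathbf{S}_j$; (2) $V_{ijk}\le B_{ik}$ and $V_{ijk}\le B_{jk}$ if $\{i,j,k\}\subset \mathbf{S}_i\cap\mathbf{S}_j\cap\mathbf{S}_k$; (3) $B_{ik}+B_{jk}\le 1+V_{ijk}$ if $\{i,j,k\}\subset \mathbf{S}_i\cap\mathbf{S}_j\cap\mathbf{S}_k$; (4) $V_{ijk}\le S_{ij}$ if $\{i,j,k\}\subset \mathbf{S}_i\cap\mathbf{S}_j\cap\mathbf{S}_k$; (5) $S_{ij}\le\sum_{k}V_{ijk}$ where $\{i,j,k\}\subset \mathbf{S}_i\cap\mathbf{S}_j\cap\mathbf{S}_k$ (the sum being over the $k$ for which the variable $V_{ijk}$ is created).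
   Context: Standing assumptions: the Markov property and causal sufficiency (all confounders are observed). Markov blanket: in a DAG on $\mathbf{X}$, $\mathbf{MB}(X_i)$ is the smallest set $M\subset\mathbf{X}\setminus\{X_i\}$ such that $X_i$ is $d$-separated from $\mathbf{X}\setminus(M\cup\{X_i\})$ given $M$. Under the standing assumptions it contains exactly the causes (parents) of $X_i$, the effects (children) of $X_i$, and the spouse variables $X_k$, i.e. those for which some $X_\ell$ is an effect of both $X_i$ and $X_k$. V-structure: the triplet $(X_i,X_j,X_k)$ forms a v-structure $X_i\to X_k\leftarrow X_j$ if $X_i$ and $X_j$ are causes of $X_k$ while $X_i$ and $X_j$ are not directly linked. ILP variables (all binary): $B_{ij}=1$ iff $X_i\to X_j$; $V_{ijk}=V_{jik}=1$ iff there is a v-structure $X_i\to X_k\leftarrow X_j$; $S_{ij}=S_{ji}=1$ iff $X_i$ and $X_j$ are spouses in the sense that there exists $k$ with $V_{ijk}=1$. The variables $B_{ij}$ and $S_{ij}$ are created if and only if $X_i\in\mathbf{MB}(X_j)$ and $X_j\in\mathbf{MB}(X_i)$; $V_{ijk}$ is created if and only if $X_i\in\mathbf{MB}(X_j)\cap\mathbf{MB}(X_k)$, $X_j\in\mathbf{MB}(X_i)\cap\mathbf{MB}(X_k)$ and $X_k\in\mathbf{MB}(X_i)\cap\mathbf{MB}(X_j)$.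
   Formalization: Constraint (3) is false if X_i and X_j are linked parents of X_k (e.g. 1→2, 1→3, 2→3); it is proved for X_i, X_j not directly linked, and (1)–(5) are also proved unrestricted with V_ijk=1 iff X_i→X_k←X_j, linked or not, and S defined from that V. *)

theory Defs
  imports Main
begin

text \<open>
  The variables X_1, ..., X_d are represented by their indices 1, ..., d; a directed graph on
  them is its edge set, a pair (i, j) standing for the edge from X_i to X_j (X_i is a cause of X_j).
\<close>

type_synonym graph = "(nat \<times> nat) set"

definition dag_on :: "nat \<Rightarrow> graph \<Rightarrow> bool" where
  "dag_on d E \<longleftrightarrow> E \<subseteq> {1..d} \<times> {1..d} \<and> acyclic E"

definition linked :: "graph \<Rightarrow> nat \<Rightarrow> nat \<Rightarrow> bool" where
  "linked E i j \<longleftrightarrow> (i, j) \<in> E \<or> (j, i) \<in> E"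

definition trail :: "graph \<Rightarrow> nat list \<Rightarrow> bool" where
  "trail E p \<longleftrightarrow> p \<noteq> [] \<and> distinct p \<and> (\<forall>m. Suc m < length p \<longrightarrow> linked E (p ! m) (p ! Suc m))"

text \<open>Pearl's blocking criterion at an interior position of a trail; the reflexive closure makes
  a collider itself count among its descendants.\<close>

definition collider_at :: "graph \<Rightarrow> nat list \<Rightarrow> nat \<Rightarrow> bool" where
  "collider_at E p m \<longleftrightarrow> (p ! (m - 1), p ! m) \<in> E \<and> (p ! Suc m, p ! m) \<in> E"

definition blocked :: "graph \<Rightarrow> nat set \<Rightarrow> nat list \<Rightarrow> bool" where
  "blocked E Z p \<longleftrightarrow> (\<exists>m. 0 < m \<and> Suc m < length p \<and>
     (if collider_at E p m then \<forall>z\<in>Z. (p ! m, z) \<notin> E\<^sup>* else p ! m \<in> Z))"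

definition d_separated :: "graph \<Rightarrow> nat set \<Rightarrow> nat set \<Rightarrow> nat set \<Rightarrow> bool" where
  "d_separated E A C Z \<longleftrightarrow>
     (\<forall>p. trail E p \<and> hd p \<in> A \<and> last p \<in> C \<longrightarrow> blocked E Z p)"

definition separating :: "nat \<Rightarrow> graph \<Rightarrow> nat \<Rightarrow> nat set \<Rightarrow> bool" where
  "separating d E i M \<longleftrightarrow> M \<subseteq> {1..d} - {i} \<and> d_separated E {i} ({1..d} - (M \<union> {i})) M"

text \<open>``Smallest'' is read as least with respect to inclusion.\<close>

definition is_markov_blanket :: "nat \<Rightarrow> graph \<Rightarrow> nat \<Rightarrow> nat set \<Rightarrow> bool" where
  "is_markov_blanket d E i M \<longleftrightarrow>
     separating d E i M \<and> (\<forall>M'. separating d E i M' \<longrightarrow> M \<subseteq> M')"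

text \<open>The local sets S_i, consisting of X_i and its Markov blanket.\<close>

definition local_set :: "(nat \<Rightarrow> nat set) \<Rightarrow> nat \<Rightarrow> nat set" where
  "local_set MB i = {i} \<union> MB i"

definition collider :: "graph \<Rightarrow> nat \<Rightarrow> nat \<Rightarrow> nat \<Rightarrow> bool" where
  "collider E i j k \<longleftrightarrow> i \<noteq> j \<and> (i, k) \<in> E \<and> (j, k) \<in> E"

definition v_structure :: "graph \<Rightarrow> nat \<Rightarrow> nat \<Rightarrow> nat \<Rightarrow> bool" where
  "v_structure E i j k \<longleftrightarrow> collider E i j k \<and> \<not> linked E i j"

text \<open>
  The binary variables are total 0/1 functions of their indices.  The second-order argument
  is the relation that V encodes: v-structures or, alternatively, arbitrary colliders.
  Whether V_ijk is part of the program depends on the blankets only and is a separate predicate.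
\<close>

definition B_var :: "graph \<Rightarrow> nat \<Rightarrow> nat \<Rightarrow> nat" where
  "B_var E i j = of_bool ((i, j) \<in> E)"

definition V_var :: "(nat \<Rightarrow> nat \<Rightarrow> nat \<Rightarrow> bool) \<Rightarrow> nat \<Rightarrow> nat \<Rightarrow> nat \<Rightarrow> nat" where
  "V_var R i j k = of_bool (R i j k)"

definition S_var :: "nat \<Rightarrow> (nat \<Rightarrow> nat \<Rightarrow> nat \<Rightarrow> bool) \<Rightarrow> nat \<Rightarrow> nat \<Rightarrow> nat" where
  "S_var d R i j = of_bool (\<exists>k\<in>{1..d}. V_var R i j k = 1)"

definition V_created :: "(nat \<Rightarrow> nat set) \<Rightarrow> nat \<Rightarrow> nat \<Rightarrow> nat \<Rightarrow> bool" where
  "V_created MB i j k \<longleftrightarrow>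
     i \<in> MB j \<inter> MB k \<and> j \<in> MB i \<inter> MB k \<and> k \<in> MB i \<inter> MB j"

text \<open>
  With V encoding v-structures, the inequality B_ik + B_jk <= 1 + V_ijk fails for every pair of
  linked parents i, j of k, although all the variables involved are created.  It is therefore
  available only for pairs that are not linked, or with V encoding colliders.
\<close>

lemma linked_parents_violate:
  assumes "(i, k) \<in> E" "(j, k) \<in> E" "linked E i j"
  shows "\<not> B_var E i k + B_var E j k \<le> 1 + V_var (v_structure E) i j k"
  using assms by (simp add: B_var_def V_var_def v_structure_def)

end

theory Submission
  imports Defs
begin

text \<open>
  The blanket of i is identified with its parents, children and spouses. A trail leaving this set
  is blocked at its second node, or, when that node is a collider, at the third one, which is then a
  spouse and by acyclicity not itself a collider. Conversely, the trails i, j for linked j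
  and i, k, j for a common child k force linked nodes and spouses into every separating set.
\<close>

lemma separating_blanket:
  assumes "dag_on d E"
  shows "separating d E i {j. j \<noteq> i \<and> (linked E i j \<or> (\<exists>k. collider E i j k))}"
    (is "separating d E i ?M")
proof -
  have E: "E \<subseteq> {1..d} \<times> {1..d}" and acyc: "acyclic E"
    using assms by (auto simp: dag_on_def)
  have "?M \<subseteq> {1..d} - {i}"
    using E by (auto simp: linked_def collider_def)
  moreover have "blocked E ?M p"
    if p: "trail E p" and hd: "hd p = i" and last: "last p \<in> {1..d} - (?M \<union> {i})" for p
  proof -
    have ne: "p \<noteq> []" and dist: "distinct p"
      and link: "\<And>m. Suc m < length p \<Longrightarrow> linked E (p ! m) (p ! Suc m)"
      using p by (auto simp: trail_def)
    have p0: "p ! 0 = i" using hd ne by (simp add: hd_conv_nth)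
    \<comment> \<open>The trail ends outside \<open>?M\<close> and away from \<open>i\<close>. A
      node found in \<open>?M\<close> is therefore not the last one, which forces length at least
      three and, in the collider case, at least four.\<close>
    have lastp: "p ! m \<notin> ?M" "p ! m \<noteq> i" if "length p = Suc m" for m
      using last ne that by (auto simp: last_conv_nth)
    have "length p \<noteq> Suc 0" using lastp(2)[of 0] p0 by auto
    then have len2: "Suc 0 < length p" using ne by (cases p) auto
    have "p ! 1 \<noteq> i" using dist len2 p0 by (metis One_nat_def nth_eq_iff_index_eq less_trans zero_less_Suc nat.distinct(1))
    then have p1: "p ! 1 \<in> ?M" using link[of 0] len2 p0 by auto
    then have "length p \<noteq> Suc 1" using lastp(1) by blast
    then have len3: "Suc 1 < length p" using len2 by auto
    show ?thesis
    proof (cases "collider_at E p 1")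
      case False
      then show ?thesis using p1 len3 unfolding blocked_def by (intro exI[of _ 1]) auto
    next
      case True
      \<comment> \<open>The collider \<open>p ! 1\<close> lies in \<open>?M\<close> itself and is
        thus open, so the block must come from \<open>p ! 2\<close>, which shares the child
        \<open>p ! 1\<close> with \<open>i\<close>.\<close>
      then have c: "(i, p ! 1) \<in> E" "(p ! 2, p ! 1) \<in> E"
        using p0 by (auto simp: collider_at_def numeral_2_eq_2)
      have "p ! 2 \<noteq> i"
        using dist len3 p0 by (metis One_nat_def Suc_1 nth_eq_iff_index_eq len2 less_trans zero_less_Suc nat.distinct(1))
      then have p2: "p ! 2 \<in> ?M" using c by (auto simp: collider_def)
      then have "length p \<noteq> Suc 2" using lastp(1) by blast
      then have len4: "Suc 2 < length p" using len3 by auto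
      \<comment> \<open>Both orientations together would form a cycle of length two.\<close>
      have "(p ! 1, p ! 2) \<notin> E"
        using c(2) acyc by (meson acyclic_def r_into_trancl trancl_trans)
      then have "\<not> collider_at E p 2" by (simp add: collider_at_def)
      then show ?thesis using p2 len4 unfolding blocked_def by (intro exI[of _ 2]) auto
    qed
  qed
  ultimately show ?thesis
    unfolding separating_def d_separated_def by blast
qed

text \<open>A trail of two nodes has no interior position, so no conditioning set blocks it.\<close>

lemma separating_contains_linked:
  assumes "dag_on d E" "separating d E i M" "linked E i j" "j \<noteq> i"
  shows "j \<in> M"
proof (rule ccontr)
  assume "j \<notin> M"
  then have "j \<in> {1..d} - (M \<union> {i})"
    using assms by (auto simp: dag_on_def linked_def)
  moreover have "trail E [i, j]"
    using assms by (auto simp: trail_def)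
  moreover have "\<not> blocked E M [i, j]"
    by (auto simp: blocked_def)
  ultimately show False
    using assms(2) by (auto simp: separating_def d_separated_def)
qed

text \<open>The common child \<open>k\<close> is linked to \<open>i\<close> and so already belongs
  to \<open>M\<close>. Conditioning on it opens the collider, since the reflexive closure makes
  \<open>k\<close> its own descendant.\<close>

lemma separating_contains_spouses:
  assumes dag: "dag_on d E" and sep: "separating d E i M" and col: "collider E i j k"
  shows "j \<in> M"
proof (rule ccontr)
  assume "j \<notin> M"
  have irr: "(x, x) \<notin> E" for x
    using dag by (auto simp: dag_on_def acyclic_def)
  have e: "i \<noteq> j" "(i, k) \<in> E" "(j, k) \<in> E"
    using col by (auto simp: collider_def)
  then have "k \<noteq> i" "k \<noteq> j" using irr by auto
  have "k \<in> M"
    using separating_contains_linked[OF dag sep] e \<open>k \<noteq> i\<close> by (auto simp: linked_def)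
  have "j \<in> {1..d} - (M \<union> {i})"
    using dag e \<open>j \<notin> M\<close> by (auto simp: dag_on_def)
  moreover have "trail E [i, k, j]"
    using e \<open>k \<noteq> i\<close> \<open>k \<noteq> j\<close> by (auto simp: trail_def linked_def less_Suc_eq)
  moreover have "\<not> blocked E M [i, k, j]"
    using e \<open>k \<in> M\<close> by (auto simp: blocked_def collider_at_def less_Suc_eq)
  ultimately show False
    using sep by (auto simp: separating_def d_separated_def)
qed

text \<open>Leastness works from both sides: the explicit set separates, so it contains
  \<open>M\<close>; and \<open>M\<close> separates, so it contains all linked nodes and spouses.
  Spouses come from colliders here and may also be linked to \<open>i\<close>.\<close>

lemma markov_blanket_iff:
  assumes "dag_on d E" "is_markov_blanket d E i M"
  shows "j \<in> M \<longleftrightarrow> j \<noteq> i \<and> (linked E i j \<or> (\<exists>k. collider E i j k))"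
proof
  show "j \<noteq> i \<and> (linked E i j \<or> (\<exists>k. collider E i j k))" if "j \<in> M"
    using separating_blanket[OF assms(1), of i] assms(2) that
    unfolding is_markov_blanket_def by blast
  show "j \<in> M" if "j \<noteq> i \<and> (linked E i j \<or> (\<exists>k. collider E i j k))"
    using that assms separating_contains_linked separating_contains_spouses
    unfolding is_markov_blanket_def by blast
qed

text \<open>A witness \<open>k\<close> for \<open>S_var\<close> equal to 1 contributes a summand 1,
  because the assumption puts it into the index set. Keeping \<open>R\<close> arbitrary serves
  v-structures and colliders alike.\<close>

lemma S_var_le_sum:
  assumes "\<And>k. k \<in> {1..d} \<Longrightarrow> R i j k \<Longrightarrow> V_created MB i j k"
  shows "S_var d R i j \<le> (\<Sum>k | k \<in> {1..d} \<and> V_created MB i j k. V_var R i j k)"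
proof (cases "\<exists>k\<in>{1..d}. R i j k")
  case True
  then obtain k where k: "k \<in> {1..d}" "R i j k" by blast
  have "V_var R i j k \<le> (\<Sum>k | k \<in> {1..d} \<and> V_created MB i j k. V_var R i j k)"
    using k assms by (intro member_le_sum) auto
  then show ?thesis using k by (simp add: V_var_def S_var_def)
qed (simp add: S_var_def V_var_def)

text \<open>Both readings of V are covered because the bound on
  \<open>B_var E i k + B_var E j k\<close> separates them: v-structures need unlinked parents there
  (see \<open>linked_parents_violate\<close>), whereas colliders satisfy all the constraints without
  that guard.\<close>

theorem proposition5:
  fixes d :: nat and E :: graph and MB :: "nat \<Rightarrow> nat set"
  assumes "dag_on d E"
    and "\<And>i. i \<in> {1..d} \<Longrightarrow> is_markov_blanket d E i (MB i)"
  shows "(\<forall>i\<in>{1..d}. \<forall>j\<in>{1..d}. i \<noteq> j \<longrightarrow>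
        ({i, j} \<subseteq> local_set MB i \<inter> local_set MB j \<longrightarrow>
          B_var E i j + B_var E j i + S_var d (v_structure E) i j \<ge> 1) \<and>
        S_var d (v_structure E) i j \<le> (\<Sum>k | k \<in> {1..d} \<and> V_created MB i j k. V_var (v_structure E) i j k))
    \<and> (\<forall>i\<in>{1..d}. \<forall>j\<in>{1..d}. \<forall>k\<in>{1..d}. i \<noteq> j \<and> j \<noteq> k \<and> k \<noteq> i \<and>
        {i, j, k} \<subseteq> local_set MB i \<inter> local_set MB j \<inter> local_set MB k \<longrightarrow>
        V_var (v_structure E) i j k \<le> B_var E i k \<and> V_var (v_structure E) i j k \<le> B_var E j k \<and>
        (\<not> linked E i j \<longrightarrow> B_var E i k + B_var E j k \<le> 1 + V_var (v_structure E) i j k) \<and>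
        V_var (v_structure E) i j k \<le> S_var d (v_structure E) i j)
    \<and> (\<forall>i\<in>{1..d}. \<forall>j\<in>{1..d}. i \<noteq> j \<longrightarrow>
        ({i, j} \<subseteq> local_set MB i \<inter> local_set MB j \<longrightarrow>
          B_var E i j + B_var E j i + S_var d (collider E) i j \<ge> 1) \<and>
        S_var d (collider E) i j \<le> (\<Sum>k | k \<in> {1..d} \<and> V_created MB i j k. V_var (collider E) i j k))
    \<and> (\<forall>i\<in>{1..d}. \<forall>j\<in>{1..d}. \<forall>k\<in>{1..d}. i \<noteq> j \<and> j \<noteq> k \<and> k \<noteq> i \<and>
        {i, j, k} \<subseteq> local_set MB i \<inter> local_set MB j \<inter> local_set MB k \<longrightarrow>
        V_var (collider E) i j k \<le> B_var E i k \<and> V_var (collider E) i j k \<le> B_var E j k \<and>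
        B_var E i k + B_var E j k \<le> 1 + V_var (collider E) i j k \<and>
        V_var (collider E) i j k \<le> S_var d (collider E) i j)"
proof -
  have E: "E \<subseteq> {1..d} \<times> {1..d}" and irr: "\<And>x. (x, x) \<notin> E"
    using assms(1) by (auto simp: dag_on_def acyclic_def)
  have mb: "y \<in> MB x \<longleftrightarrow> y \<noteq> x \<and> (linked E x y \<or> (\<exists>k. collider E x y k))"
    if "x \<in> {1..d}" for x y
    using markov_blanket_iff assms that by blast
  \<comment> \<open>Each parent is linked to the child, and the parents are spouses through
    \<open>k\<close>; so the three nodes lie in each other's blankets. Hence any V equal to 1 is
    created.\<close>
  have created: "V_created MB i j k" if "collider E i j k" for i j k
  proof -
    have c: "i \<noteq> j" "(i, k) \<in> E" "(j, k) \<in> E"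
      using that by (auto simp: collider_def)
    then have "i \<in> {1..d}" "j \<in> {1..d}" "k \<in> {1..d}" "i \<noteq> k" "j \<noteq> k"
      using E irr by auto
    with c show ?thesis
      by (auto simp: V_created_def mb linked_def collider_def)
  qed
  \<comment> \<open>Without a link only the spouse clause of \<open>mb\<close> remains. The child is
    in \<open>{1..d}\<close>, as the bounded quantifier in \<open>S_var\<close> requires, because
    \<open>E\<close> is.\<close>
  have common_child: "\<exists>k\<in>{1..d}. collider E i j k"
    if "i \<in> {1..d}" "i \<noteq> j" "\<not> linked E i j" "{i, j} \<subseteq> local_set MB i \<inter> local_set MB j" for i j
    using that E mb[of i j] by (auto simp: local_set_def collider_def)
  \<comment> \<open>A link makes one of the two B terms 1; without a link the common child yields a
    v-structure, so the S term is 1.\<close>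
  have cover_v: "B_var E i j + B_var E j i + S_var d (v_structure E) i j \<ge> 1"
    if "i \<in> {1..d}" "i \<noteq> j" "{i, j} \<subseteq> local_set MB i \<inter> local_set MB j" for i j
    using common_child[OF that(1,2) _ that(3)]
    by (cases "linked E i j") (auto simp: B_var_def S_var_def V_var_def v_structure_def linked_def)
  have cover_c: "B_var E i j + B_var E j i + S_var d (collider E) i j \<ge> 1"
    if "i \<in> {1..d}" "i \<noteq> j" "{i, j} \<subseteq> local_set MB i \<inter> local_set MB j" for i j
    using common_child[OF that(1,2) _ that(3)]
    by (cases "linked E i j") (auto simp: B_var_def S_var_def V_var_def linked_def)
  have sum_v: "S_var d (v_structure E) i j
      \<le> (\<Sum>k | k \<in> {1..d} \<and> V_created MB i j k. V_var (v_structure E) i j k)" for i j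
    by (rule S_var_le_sum) (simp add: v_structure_def created)
  have sum_c: "S_var d (collider E) i j
      \<le> (\<Sum>k | k \<in> {1..d} \<and> V_created MB i j k. V_var (collider E) i j k)" for i j
    by (rule S_var_le_sum) (rule created)
  \<comment> \<open>The same \<open>k\<close> witnesses \<open>S_var\<close>, which is why it has to
    be in range.\<close>
  have V_le: "V_var R i j k \<le> B_var E i k \<and> V_var R i j k \<le> B_var E j k \<and>
      V_var R i j k \<le> S_var d R i j"
    if "k \<in> {1..d}" "\<And>i j k. R i j k \<Longrightarrow> collider E i j k" for R i j k
    using that by (auto simp: V_var_def B_var_def S_var_def collider_def)
  have V_le_v: "V_var (v_structure E) i j k \<le> B_var E i k"
      "V_var (v_structure E) i j k \<le> B_var E j k"
      "V_var (v_structure E) i j k \<le> S_var d (v_structure E) i j" if "k \<in> {1..d}" for i j k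
    using V_le[of k "v_structure E"] that by (auto simp: v_structure_def)
  have V_le_c: "V_var (collider E) i j k \<le> B_var E i k"
      "V_var (collider E) i j k \<le> B_var E j k"
      "V_var (collider E) i j k \<le> S_var d (collider E) i j" if "k \<in> {1..d}" for i j k
    using V_le[of k "collider E"] that by auto
  \<comment> \<open>The bound only bites when both edges into \<open>k\<close> are present;
    \<open>i\<close> and \<open>j\<close>, being distinct and unlinked, then form a
    v-structure.\<close>
  have V_ge_v: "B_var E i k + B_var E j k \<le> 1 + V_var (v_structure E) i j k"
    if "i \<noteq> j" "\<not> linked E i j" for i j k
    using that by (auto simp: V_var_def B_var_def v_structure_def collider_def)
  have V_ge_c: "B_var E i k + B_var E j k \<le> 1 + V_var (collider E) i j k"
    if "i \<noteq> j" for i j k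
    using that by (auto simp: V_var_def B_var_def collider_def)
  show ?thesis
    by (intro conjI ballI impI)
      (blast intro: cover_v cover_c sum_v sum_c V_le_v V_le_c V_ge_v V_ge_c)+
qed

end
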